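(* Let $d$ be a nonnegative integer. A Young diagram $\lambda$ is the minimal element (with respect to inclusion) in a nontrivial $\stackrel{d}{\sim}$-equivalence class if and only if $\lambda(d)$ is a Young diagram. In particular, the nontrivial $\stackrel{d}{\sim}$-equivalence classes are parametrized by Young diagrams of size $d$. Moreover, if $\{\lambda^{(0)}\subset\lambda^{(1)}\subset\cdots\}$ is a nontrivial $\stackrel{d}{\sim}$-equivalence class, then for each $i\ge0$ the Young diagram $\lambda^{(i)}$ is obtained from the Young diagram $\lambda^{(0)}(d)$ (whose rows are numbered $0,1,2,\ldots$) by removing row $i$ and adding one box to row $j$ for each $j=0,\ldots,i-1$.
   Context: A Young diagram is a sequence $\lambda=(\lambda_1,\lambda_2,\ldots)$ of nonnegative integers with $\lambda_i\ge\lambda_{i+1}$ for all $i$ and $\lambda_k=0$ for some $k$; $|\lambda|=\sum\lambda_i$ is its size; $\lambda\subset\lambda'$ means $\lambda_i\le\lambda_i'$ for all $i$. The $d$-completion of $\lambda$ is $\lambda(d):=(d-|\lambda|,\lambda_1,\lambda_2,\ldots)$. Put $\mu_\lambda(d)=(d-|\lambda|,\lambda_1-1,\lambda_2-2,\ldots)=(\mu_0,\mu_1,\ldots)$ and similarly $\mu_{\lambda'}(d)=(\mu_0',\mu_1',\ldots)$. Then $\lambda\stackrel{d}{\sim}\lambda'$ means there is a bijection $\tau:\mathbb{Z}_{\ge0}\to\mathbb{Z}_{\ge0}$ with $\mu_i=\mu'_{\tau(i)}$ for all $i\ge0$. A $\stackrel{d}{\sim}$-equivalence class is trivial if it contains only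 one Young diagram. The Young diagrams of a nontrivial class form an infinite strictly increasing chain $\lambda^{(0)}\subset\lambda^{(1)}\subset\cdots$. *)

theory Defs
  imports Main
begin

text \<open>
  Diagrams are integer sequences, so that the completion below, whose first entry may be negative,
  is subject to the same predicate. Entry \<open>lam i\<close> is \<open>\<lambda>\<^sub>i\<^sub>+\<^sub>1\<close>.
\<close>

definition young_diagram :: "(nat \<Rightarrow> int) \<Rightarrow> bool" where
  "young_diagram lam \<longleftrightarrow>
     (\<forall>i. lam i \<ge> 0) \<and> (\<forall>i. lam i \<ge> lam (Suc i)) \<and> (\<exists>k. lam k = 0)"

text \<open>The support of a Young diagram is finite, so this is the sum of all its entries.\<close>

definition diagram_size :: "(nat \<Rightarrow> int) \<Rightarrow> int" where
  "diagram_size lam = (\<Sum>i | lam i \<noteq> 0. lam i)"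

definition completion :: "nat \<Rightarrow> (nat \<Rightarrow> int) \<Rightarrow> nat \<Rightarrow> int" where
  "completion d lam i = (case i of 0 \<Rightarrow> int d - diagram_size lam | Suc j \<Rightarrow> lam j)"

definition mu :: "nat \<Rightarrow> (nat \<Rightarrow> int) \<Rightarrow> nat \<Rightarrow> int" where
  "mu d lam i = completion d lam i - int i"

definition d_equiv :: "nat \<Rightarrow> ((nat \<Rightarrow> int) \<times> (nat \<Rightarrow> int)) set" where
  "d_equiv d = {(lam, lam'). young_diagram lam \<and> young_diagram lam' \<and>
     (\<exists>\<tau> :: nat \<Rightarrow> nat. bij \<tau> \<and> (\<forall>i. mu d lam i = mu d lam' (\<tau> i)))}"

lemma equiv_d_equiv: "equiv {lam. young_diagram lam} (d_equiv d)"
proof (rule equivI)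
  show "d_equiv d \<subseteq> {lam. young_diagram lam} \<times> {lam. young_diagram lam}"
    by (auto simp: d_equiv_def)
  show "refl_on {lam. young_diagram lam} (d_equiv d)"
    by (auto simp: d_equiv_def refl_on_def intro!: exI[of _ id])
  show "sym (d_equiv d)"
  proof (rule symI)
    fix lam lam' assume "(lam, lam') \<in> d_equiv d"
    then obtain \<tau> :: "nat \<Rightarrow> nat" where y: "young_diagram lam" "young_diagram lam'"
      and \<tau>: "bij \<tau>" "\<forall>i. mu d lam i = mu d lam' (\<tau> i)"
      by (auto simp: d_equiv_def)
    then have "\<forall>i. mu d lam' i = mu d lam (inv \<tau> i)"
      by (simp add: bij_is_surj surj_f_inv_f)
    with y \<tau> show "(lam', lam) \<in> d_equiv d"
      by (auto simp: d_equiv_def intro!: exI[of _ "inv \<tau>"] bij_imp_bij_inv)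
  qed
  show "trans (d_equiv d)"
  proof (rule transI)
    fix a b c assume "(a, b) \<in> d_equiv d" "(b, c) \<in> d_equiv d"
    then obtain \<sigma> \<tau> :: "nat \<Rightarrow> nat" where "young_diagram a" "young_diagram c"
      and "bij \<sigma>" "\<forall>i. mu d a i = mu d b (\<sigma> i)" "bij \<tau>" "\<forall>i. mu d b i = mu d c (\<tau> i)"
      by (auto simp: d_equiv_def)
    then show "(a, c) \<in> d_equiv d"
      by (auto simp: d_equiv_def intro!: exI[of _ "\<tau> \<circ> \<sigma>"] bij_comp)
  qed
qed

definition nontrivial_classes :: "nat \<Rightarrow> (nat \<Rightarrow> int) set set" where
  "nontrivial_classes d = {C \<in> {lam. young_diagram lam} // d_equiv d. \<not> (\<exists>lam. C = {lam})}"

text \<open>Rows are numbered from 0. Inclusion of diagrams is the pointwise order \<open>\<le>\<close> on functions.\<close>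

definition remove_row :: "nat \<Rightarrow> (nat \<Rightarrow> int) \<Rightarrow> nat \<Rightarrow> int" where
  "remove_row i lam j = (if j < i then lam j else lam (Suc j))"

definition add_box :: "nat set \<Rightarrow> (nat \<Rightarrow> int) \<Rightarrow> nat \<Rightarrow> int" where
  "add_box J lam j = (if j \<in> J then lam j + 1 else lam j)"

end

theory Submission imports Defs begin

text \<open>
  Bijections between the sequences \<open>\<mu>\<close> compare multisets \<open>{d - \<bar>\<lambda>\<bar>} + B\<close>, where \<open>B\<close> consists of the
  entries \<open>\<lambda>\<^sub>j - j\<close> with \<open>j \<ge> 1\<close>; these are strictly decreasing, so \<open>B\<close> determines \<open>\<lambda>\<close>. If
  \<open>d - \<bar>\<lambda>\<bar>\<close> lies in \<open>B\<close>, it is the only repeated element, hence recoverable from the multiset, and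
  the class is trivial. Otherwise the multiset is a set \<open>{s\<^sub>0 > s\<^sub>1 > \<dots>}\<close>, the numbers \<open>s\<^sub>j + j\<close> form a
  Young diagram \<open>\<kappa>\<close> of size \<open>d\<close>, and the members of the class are obtained by choosing which \<open>s\<^sub>i\<close>
  comes first: this removes row \<open>i\<close> of \<open>\<kappa>\<close> and lengthens the rows above it.
\<close>

text \<open>Writing \<open>f n = g (\<sigma> n)\<close> makes \<open>\<sigma>\<close> strictly
  increasing, so \<open>n \<le> \<sigma> n\<close> and \<open>g n \<le> f n\<close>; the roles are
  then exchanged.\<close>

lemma strict_mono_same_range_eq:
  fixes f g :: "nat \<Rightarrow> 'a::order"
  assumes f: "strict_mono f" and g: "strict_mono g" and r: "range f = range g"
  shows "f = g"
proof -
  have le: "g n \<le> f n"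
    if f: "strict_mono f" and g: "strict_mono g" and r: "range f = range g"
    for f g :: "nat \<Rightarrow> 'a" and n
  proof -
    have "\<forall>n. \<exists>m. f n = g m" using r by (metis rangeI rangeE)
    then obtain \<sigma> where \<sigma>: "\<And>n. f n = g (\<sigma> n)" by metis
    have "strict_mono \<sigma>"
      by (rule strict_monoI) (metis \<sigma> f g strict_mono_less)
    then have "n \<le> \<sigma> n" by (rule strict_mono_imp_increasing)
    then show ?thesis using \<sigma> g strict_mono_less_eq by metis
  qed
  show ?thesis using le[OF f g r] le[OF g f r[symmetric]] by (auto intro: order.antisym)
qed

section \<open>Young diagrams as decreasing, eventually zero sequences\<close>

lemma young_diagram_antimono:
  assumes "young_diagram lam" "i \<le> j" shows "lam j \<le> lam i"
  using assms lift_Suc_antimono_le[of lam i j] unfolding young_diagram_def by blast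

lemma young_diagramE:
  assumes "young_diagram lam"
  obtains n where "\<And>j. n \<le> j \<Longrightarrow> lam j = 0"
proof -
  obtain n where n: "lam n = 0" using assms by (auto simp: young_diagram_def)
  have "lam j = 0" if "n \<le> j" for j
    using young_diagram_antimono[OF assms that] n assms
    by (metis order.antisym young_diagram_def)
  then show ?thesis by (rule that)
qed

text \<open>Nonnegativity comes for free: each entry dominates a later one that is zero.\<close>

lemma young_diagramI:
  assumes dec: "\<And>i. lam (Suc i) \<le> lam i" and z: "\<And>j. n \<le> j \<Longrightarrow> lam j = 0"
  shows "young_diagram lam"
proof -
  have "0 \<le> lam i" for i
    using lift_Suc_antimono_le[of lam i "max i n"] dec z[of "max i n"] by simp
  then show ?thesis using dec z[of n] by (auto simp: young_diagram_def)
qed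

lemma diagram_size_eq_sum:
  assumes "\<And>j. n \<le> j \<Longrightarrow> lam j = 0"
  shows "diagram_size lam = (\<Sum>j<n. lam j)"
  unfolding diagram_size_def
  by (rule sum.mono_neutral_left) (use assms in \<open>force simp: not_less[symmetric]\<close>)+

section \<open>The tail of \<open>mu\<close> and the diagram it determines\<close>

lemma strict_mono_minus_mu_Suc:
  assumes "young_diagram lam"
  shows "strict_mono (\<lambda>j. - mu d lam (Suc j))"
  unfolding strict_mono_Suc_iff
  using assms by (auto simp: mu_def completion_def young_diagram_def)
    (smt (verit))

lemma mu_Suc_inj:
  assumes "young_diagram lam" "mu d lam (Suc i) = mu d lam (Suc j)"
  shows "i = j"
  using strict_mono_eq[OF strict_mono_minus_mu_Suc[OF assms(1), of d]] assms(2) by simp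

lemma mu_Suc_range_eq_imp_eq:
  assumes "young_diagram lam" "young_diagram lam'"
    and r: "range (\<lambda>j. mu d lam (Suc j)) = range (\<lambda>j. mu d lam' (Suc j))"
  shows "lam = lam'"
proof -
  have "range (\<lambda>j. - mu d lam (Suc j)) = range (\<lambda>j. - mu d lam' (Suc j))"
    using arg_cong[OF r, of "image uminus"] by (simp add: image_image)
  then have "(\<lambda>j. - mu d lam (Suc j)) = (\<lambda>j. - mu d lam' (Suc j))"
    using strict_mono_same_range_eq strict_mono_minus_mu_Suc assms(1,2) by blast
  then show ?thesis by (auto simp: mu_def completion_def fun_eq_iff)
qed

section \<open>The chain attached to a Young diagram\<close>

definition chain_diagram :: "(nat \<Rightarrow> int) \<Rightarrow> nat \<Rightarrow> nat \<Rightarrow> int" where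
  "chain_diagram kap i = add_box {..<i} (remove_row i kap)"

lemma chain_diagram_apply:
  "chain_diagram kap i j = (if j < i then kap j + 1 else kap (Suc j))"
  by (simp add: chain_diagram_def add_box_def remove_row_def)

lemma chain_diagram_0_completion: "chain_diagram (completion d lam) 0 = lam"
  by (auto simp: chain_diagram_apply completion_def)

lemma young_diagram_chain_diagram:
  assumes "young_diagram kap"
  shows "young_diagram (chain_diagram kap i)"
proof -
  obtain n where n: "\<And>j. n \<le> j \<Longrightarrow> kap j = 0" using young_diagramE[OF assms] by blast
  have dec: "kap (Suc j) \<le> kap j" for j using young_diagram_antimono[OF assms, of j "Suc j"] by simp
  show ?thesis
  proof (rule young_diagramI[where n = "max i n"])
    show "chain_diagram kap i (Suc j) \<le> chain_diagram kap i j" for j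
      using dec[of j] dec[of "Suc j"] by (auto simp: chain_diagram_apply)
    show "chain_diagram kap i j = 0" if "max i n \<le> j" for j
      using that n by (auto simp: chain_diagram_apply)
  qed
qed

lemma diagram_size_chain_diagram:
  assumes "young_diagram kap"
  shows "diagram_size (chain_diagram kap i) = diagram_size kap - kap i + int i"
proof -
  obtain n where n: "\<And>j. n \<le> j \<Longrightarrow> kap j = 0" using young_diagramE[OF assms] by blast
  \<comment> \<open>The induction starts at \<open>i\<close>, where the sum covers exactly the
    lengthened rows; beyond that both sides gain \<open>kap (Suc (i + m))\<close>.\<close>
  have shift: "(\<Sum>j<i + m. chain_diagram kap i j) = (\<Sum>j<Suc (i + m). kap j) - kap i + int i" for m
    by (induction m) (auto simp: chain_diagram_apply sum.distrib)
  have "diagram_size (chain_diagram kap i) = (\<Sum>j<i + n. chain_diagram kap i j)"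
    by (rule diagram_size_eq_sum) (use n in \<open>auto simp: chain_diagram_apply\<close>)
  moreover have "diagram_size kap = (\<Sum>j<Suc (i + n). kap j)"
    by (rule diagram_size_eq_sum) (use n in auto)
  ultimately show ?thesis using shift by simp
qed

text \<open>Consecutive members differ only in row \<open>i\<close>, which grows from
  \<open>kap (Suc i)\<close> to \<open>kap i + 1\<close>.\<close>

lemma strict_mono_chain_diagram:
  assumes "young_diagram kap"
  shows "strict_mono (chain_diagram kap)"
  unfolding strict_mono_Suc_iff
proof
  fix i
  have "kap (Suc i) < kap i + 1" using young_diagram_antimono[OF assms, of i "Suc i"] by simp
  then show "chain_diagram kap i < chain_diagram kap (Suc i)"
    by (auto simp: less_fun_def le_fun_def chain_diagram_apply less_Suc_eq intro!: exI[of _ i])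
qed

lemma completion_chain_diagram_0:
  assumes "young_diagram kap" "diagram_size kap = int d"
  shows "completion d (chain_diagram kap 0) = kap"
  using diagram_size_chain_diagram[OF assms(1), of 0] assms(2)
  by (auto simp: completion_def chain_diagram_apply fun_eq_iff split: nat.split)

text \<open>Since \<open>lam\<close> is the completion without row 0, the size formula at index 0
  applies, and the size of \<open>lam\<close> cancels.\<close>

lemma diagram_size_completion:
  assumes "young_diagram (completion d lam)"
  shows "diagram_size (completion d lam) = int d"
  using diagram_size_chain_diagram[OF assms, of 0]
  by (simp add: chain_diagram_0_completion) (simp add: completion_def)

lemma mu_chain_diagram:
  assumes "young_diagram kap" "diagram_size kap = int d"
  shows "mu d (chain_diagram kap i) 0 = kap i - int i"
    and "mu d (chain_diagram kap i) (Suc j) =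
      (if j < i then kap j - int j else kap (Suc j) - int (Suc j))"
  using diagram_size_chain_diagram[OF assms(1), of i] assms(2)
  by (auto simp: mu_def completion_def chain_diagram_apply)

text \<open>The sorted sequence \<open>kap j - j\<close> is \<open>mu\<close> of the minimal diagram; the cycle below moves its
  \<open>i\<close>-th entry to the front.\<close>

lemma chain_diagram_equiv:
  assumes "young_diagram kap" "diagram_size kap = int d"
  shows "(chain_diagram kap i, chain_diagram kap 0) \<in> d_equiv d"
proof -
  define \<tau> where "\<tau> m = (case m of 0 \<Rightarrow> i | Suc j \<Rightarrow> if j < i then j else Suc j)" for m
  define \<rho> where "\<rho> m = (if m = i then 0 else if m < i then Suc m else m)" for m
  have "bij \<tau>"
    by (rule o_bij[of \<rho>]) (auto simp: fun_eq_iff \<tau>_def \<rho>_def split: nat.split)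
  moreover have "mu d (chain_diagram kap i) m = mu d (chain_diagram kap 0) (\<tau> m)" for m
    unfolding mu_def[of d "chain_diagram kap 0"] completion_chain_diagram_0[OF assms]
    by (auto simp: mu_chain_diagram[OF assms] \<tau>_def split: nat.split)
  ultimately show ?thesis
    using young_diagram_chain_diagram[OF assms(1)] by (auto simp: d_equiv_def)
qed

text \<open>The index \<open>i = \<tau> 0\<close> says which sorted value comes first. The other
  values form the tail both of \<open>lam\<close> and of \<open>chain_diagram kap i\<close>, and the
  tail determines the diagram.\<close>

lemma equiv_chain_diagram_0:
  assumes kap: "young_diagram kap" "diagram_size kap = int d"
    and e: "(lam, chain_diagram kap 0) \<in> d_equiv d"
  shows "lam \<in> range (chain_diagram kap)"
proof -
  obtain \<tau> :: "nat \<Rightarrow> nat" where lam: "young_diagram lam" and \<tau>: "bij \<tau>"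
    and \<mu>: "\<And>i. mu d lam i = mu d (chain_diagram kap 0) (\<tau> i)"
    using e by (auto simp: d_equiv_def)
  define s where "s m = kap m - int m" for m
  have eq: "mu d lam i = s (\<tau> i)" for i
    using \<mu> unfolding s_def mu_def[of d "chain_diagram kap 0"] completion_chain_diagram_0[OF kap] by blast
  define i where "i = \<tau> 0"
  have "range (\<lambda>j. \<tau> (Suc j)) = - {i}"
  proof -
    have "range Suc = - {0}" by (auto simp: image_iff) (metis not0_implies_Suc)
    then have "range (\<lambda>j. \<tau> (Suc j)) = \<tau> ` (- {0})" by (metis image_image)
    then show ?thesis using \<tau> by (simp add: bij_image_Compl_eq i_def)
  qed
  \<comment> \<open>This is the increasing enumeration of the indices other than
    \<open>i\<close>.\<close>
  moreover have "range (\<lambda>j. if j < i then j else Suc j) = - {i}"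
  proof -
    have "m \<in> range (\<lambda>j. if j < i then j else Suc j)" if "m \<noteq> i" for m
      by (rule range_eqI[of _ _ "if m < i then m else m - 1"]) (use that in auto)
    then show ?thesis by (auto split: if_splits)
  qed
  ultimately have "s ` range (\<lambda>j. \<tau> (Suc j)) = s ` range (\<lambda>j. if j < i then j else Suc j)"
    by simp
  moreover have "mu d (chain_diagram kap i) (Suc j) = s (if j < i then j else Suc j)" for j
    by (simp add: mu_chain_diagram(2)[OF kap] s_def)
  ultimately have "range (\<lambda>j. mu d lam (Suc j)) = range (\<lambda>j. mu d (chain_diagram kap i) (Suc j))"
    unfolding image_image eq by simp
  then show ?thesis
    using mu_Suc_range_eq_imp_eq[OF lam young_diagram_chain_diagram[OF kap(1)]] by blast
qed

section \<open>Diagrams in nontrivial classes\<close>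

text \<open>If the front value recurs in the tail, the tail already has the full range of
  \<open>mu\<close>. The same then happens for \<open>lam'\<close>, and equal ranges force equal
  diagrams.\<close>

lemma mu_0_notin_tail:
  assumes e: "(lam, lam') \<in> d_equiv d" and ne: "lam \<noteq> lam'"
  shows "mu d lam 0 \<noteq> mu d lam (Suc j)"
proof
  assume rep: "mu d lam 0 = mu d lam (Suc j)"
  obtain \<tau> :: "nat \<Rightarrow> nat" where y: "young_diagram lam" "young_diagram lam'" and \<tau>: "bij \<tau>"
    and eq: "\<And>i. mu d lam i = mu d lam' (\<tau> i)"
    using e by (auto simp: d_equiv_def)
  have dist: "\<tau> 0 \<noteq> \<tau> (Suc j)" using \<tau> by (simp add: bij_def inj_eq)
  have rep': "mu d lam' (\<tau> 0) = mu d lam' (\<tau> (Suc j))" using rep eq by simp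
  \<comment> \<open>The indices \<open>\<tau> 0\<close> and \<open>\<tau> (Suc j)\<close> differ but
    carry the same value; the tail of \<open>mu d lam'\<close> is injective, so one of them is
    0.\<close>
  obtain k where k: "mu d lam' 0 = mu d lam' (Suc k)" and x0: "mu d lam 0 = mu d lam' 0"
    using dist rep' eq[of 0] mu_Suc_inj[OF y(2), of d] by (cases "\<tau> 0"; cases "\<tau> (Suc j)") metis+
  have tail: "range (\<lambda>j. mu d l (Suc j)) = range (mu d l)"
    if "mu d l 0 = mu d l (Suc m)" for l m
  proof -
    have "mu d l n \<in> range (\<lambda>j. mu d l (Suc j))" for n using that by (cases n) auto
    then show ?thesis by auto
  qed
  have "range (mu d lam) = range (mu d lam')"
    using \<tau> image_image[of "mu d lam'" \<tau> UNIV] by (simp add: eq bij_is_surj)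
  then have "lam = lam'"
    using mu_Suc_range_eq_imp_eq[OF y, of d] tail[OF rep] tail[OF k] by simp
  with ne show False ..
qed

text \<open>The front value \<open>x\<close> is absent from the tail, so it can be inserted there in
  sorted position \<open>i\<close>; adding the index to each sorted value yields
  \<open>kap\<close>.\<close>

lemma nontrivial_is_chain_diagram:
  assumes e: "(lam, lam') \<in> d_equiv d" and ne: "lam \<noteq> lam'"
  obtains kap i where "young_diagram kap" "diagram_size kap = int d" "lam = chain_diagram kap i"
proof -
  have lam: "young_diagram lam" using e by (auto simp: d_equiv_def)
  define x where "x = int d - diagram_size lam"
  have x: "x \<noteq> lam j - int (Suc j)" for j
    using mu_0_notin_tail[OF e ne, of j] by (simp add: mu_def completion_def x_def)
  have dec: "lam (Suc j) \<le> lam j" for j using lam by (simp add: young_diagram_def)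
  obtain n where n: "\<And>j. n \<le> j \<Longrightarrow> lam j = 0" using young_diagramE[OF lam] by blast
  have ex: "\<exists>j. lam j - int (Suc j) < x"
    by (rule exI[of _ "n + nat \<bar>x\<bar>"]) (simp add: n)
  define i where "i = (LEAST j. lam j - int (Suc j) < x)"
  have i1: "lam i - int (Suc i) < x" unfolding i_def using ex by (rule LeastI_ex)
  have i2: "x < lam j - int (Suc j)" if "j < i" for j
    using not_less_Least[of j] that x[of j] unfolding i_def by fastforce
  \<comment> \<open>Values before position \<open>i\<close> keep their index, so
    \<open>lam j - int (Suc j)\<close> becomes \<open>lam j - 1\<close>; values after it move one
    place down, which cancels the offset.\<close>
  define kap where
    "kap j = (if j < i then lam j - 1 else if j = i then x + int i else lam (j - 1))" for j
  have kap: "young_diagram kap"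
  proof (rule young_diagramI[where n = "Suc (max i n)"])
    show "kap (Suc j) \<le> kap j" for j
    proof -
      consider "Suc j < i" | "Suc j = i" | "j = i" | "i < j" by linarith
      then show ?thesis
      proof cases
        case 2 then show ?thesis using i2[of j] by (simp add: kap_def)
      next
        case 3 then show ?thesis using i1 by (simp add: kap_def)
      next
        case 4 then show ?thesis using dec[of "j - 1"] by (simp add: kap_def)
      qed (use dec[of j] in \<open>simp add: kap_def\<close>)
    qed
    show "kap j = 0" if "Suc (max i n) \<le> j" for j using that n[of "j - 1"] by (auto simp: kap_def)
  qed
  have lam_eq: "lam = chain_diagram kap i"
    by (auto simp: fun_eq_iff chain_diagram_apply kap_def)
  have "diagram_size kap = int d"
    \<comment> \<open>The formula makes the size of \<open>lam\<close> equal to that of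
      \<open>kap\<close> minus \<open>x\<close>, and \<open>x\<close> is \<open>d\<close> minus the
      size of \<open>lam\<close>.\<close>
    using diagram_size_chain_diagram[OF kap, of i] by (simp flip: lam_eq) (simp add: kap_def x_def)
  then show ?thesis using that kap lam_eq by blast
qed

section \<open>Nontrivial classes as chains\<close>

lemma class_chain_diagram:
  assumes "young_diagram kap" "diagram_size kap = int d"
  shows "d_equiv d `` {chain_diagram kap i} = range (chain_diagram kap)"
proof -
  have "d_equiv d `` {chain_diagram kap i} = d_equiv d `` {chain_diagram kap 0}"
    using equiv_class_eq[OF equiv_d_equiv chain_diagram_equiv[OF assms]] .
  moreover have "sym (d_equiv d)" using equiv_d_equiv by (rule equivE)
  ultimately show ?thesis
    using equiv_chain_diagram_0[OF assms] chain_diagram_equiv[OF assms] by (blast dest: symD)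
qed

lemma nontrivial_classes_eq:
  "nontrivial_classes d =
    (\<lambda>kap. range (chain_diagram kap)) ` {kap. young_diagram kap \<and> diagram_size kap = int d}"
proof (intro set_eqI iffI)
  fix C assume "C \<in> nontrivial_classes d"
  then obtain lam where C: "C = d_equiv d `` {lam}" and "young_diagram lam" and nt: "C \<noteq> {lam}"
    by (auto simp: nontrivial_classes_def quotient_def)
  then have "lam \<in> C" using equiv_class_self[OF equiv_d_equiv] by blast
  with nt C obtain lam' where "(lam, lam') \<in> d_equiv d" "lam \<noteq> lam'" by blast
  then obtain kap i where k: "young_diagram kap" "diagram_size kap = int d"
    "lam = chain_diagram kap i" by (rule nontrivial_is_chain_diagram)
  then have "C = range (chain_diagram kap)" using class_chain_diagram C by simp
  with k show "C \<in> (\<lambda>kap. range (chain_diagram kap)) `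
      {kap. young_diagram kap \<and> diagram_size kap = int d}" by blast
next
  fix C assume "C \<in> (\<lambda>kap. range (chain_diagram kap)) `
      {kap. young_diagram kap \<and> diagram_size kap = int d}"
  then obtain kap where k: "young_diagram kap" "diagram_size kap = int d"
    and C: "C = range (chain_diagram kap)" by blast
  have "C \<in> {lam. young_diagram lam} // d_equiv d"
    using quotientI[of "chain_diagram kap 0" "{lam. young_diagram lam}" "d_equiv d"]
      young_diagram_chain_diagram[OF k(1), of 0]
    by (simp add: class_chain_diagram[OF k] C)
  \<comment> \<open>Two distinct members rule out a singleton class.\<close>
  moreover have "chain_diagram kap 0 \<noteq> chain_diagram kap 1"
    using strict_mono_eq[OF strict_mono_chain_diagram[OF k(1)], of 0 1] by simp
  ultimately show "C \<in> nontrivial_classes d"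
    unfolding nontrivial_classes_def C by (auto dest: singleton_inject) (metis rangeI singletonD)
qed

lemma chain_diagram_0_le:
  assumes "young_diagram kap" "lam \<in> range (chain_diagram kap)"
  shows "chain_diagram kap 0 \<le> lam"
  using assms strict_mono_less_eq[OF strict_mono_chain_diagram[OF assms(1)], of 0] by auto

theorem corollary5p9:
  fixes d :: nat
  shows "(\<forall>lam. young_diagram lam \<longrightarrow>
            ((\<exists>C \<in> nontrivial_classes d. lam \<in> C \<and> (\<forall>lam' \<in> C. lam \<le> lam'))
              \<longleftrightarrow> young_diagram (completion d lam)))
       \<and> bij_betw (\<lambda>C. completion d (LEAST lam. lam \<in> C))
            (nontrivial_classes d) {kap. young_diagram kap \<and> diagram_size kap = int d}
       \<and> (\<forall>L :: nat \<Rightarrow> nat \<Rightarrow> int. strict_mono L \<and> range L \<in> nontrivial_classes d \<longrightarrow>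
            (\<forall>i. L i = add_box {..<i} (remove_row i (completion d (L 0)))))"
proof (intro conjI allI impI)
  fix lam :: "nat \<Rightarrow> int"
  show "(\<exists>C \<in> nontrivial_classes d. lam \<in> C \<and> (\<forall>lam' \<in> C. lam \<le> lam'))
      \<longleftrightarrow> young_diagram (completion d lam)"
  proof
    assume "\<exists>C \<in> nontrivial_classes d. lam \<in> C \<and> (\<forall>lam' \<in> C. lam \<le> lam')"
    then obtain kap where k: "young_diagram kap" "diagram_size kap = int d"
      and "lam \<in> range (chain_diagram kap)" "lam \<le> chain_diagram kap 0"
      by (auto simp: nontrivial_classes_eq)
    then have "lam = chain_diagram kap 0" using chain_diagram_0_le by (blast intro: order.antisym)
    then show "young_diagram (completion d lam)" using completion_chain_diagram_0[OF k] k by simp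
  next
    assume y: "young_diagram (completion d lam)"
    have "range (chain_diagram (completion d lam)) \<in> nontrivial_classes d"
      using y diagram_size_completion[OF y] by (auto simp: nontrivial_classes_eq)
    moreover have "lam \<in> range (chain_diagram (completion d lam))"
      by (rule range_eqI[of _ _ 0]) (simp add: chain_diagram_0_completion)
    ultimately show "\<exists>C \<in> nontrivial_classes d. lam \<in> C \<and> (\<forall>lam' \<in> C. lam \<le> lam')"
      using chain_diagram_0_le[OF y] by (metis chain_diagram_0_completion)
  qed
next
  have least: "completion d (LEAST lam. lam \<in> range (chain_diagram kap)) = kap"
    if k: "young_diagram kap" "diagram_size kap = int d" for kap
  proof -
    have "(LEAST lam. lam \<in> range (chain_diagram kap)) = chain_diagram kap 0"
      by (rule Least_equality) (use chain_diagram_0_le[OF k(1)] in auto)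
    then show ?thesis using completion_chain_diagram_0[OF k] by simp
  qed
  show "bij_betw (\<lambda>C. completion d (LEAST lam. lam \<in> C))
      (nontrivial_classes d) {kap. young_diagram kap \<and> diagram_size kap = int d}"
    by (rule bij_betw_byWitness[where f' = "\<lambda>kap. range (chain_diagram kap)"])
      (auto simp: nontrivial_classes_eq least)
next
  fix L :: "nat \<Rightarrow> nat \<Rightarrow> int" and i
  assume L: "strict_mono L \<and> range L \<in> nontrivial_classes d"
  then obtain kap where k: "young_diagram kap" "diagram_size kap = int d"
    and r: "range L = range (chain_diagram kap)"
    by (auto simp: nontrivial_classes_eq)
  \<comment> \<open>A chain has only one strictly increasing enumeration by the naturals; hence
    \<open>L 0\<close> is \<open>chain_diagram kap 0\<close>, whose completion is
    \<open>kap\<close>.\<close>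
  have "L = chain_diagram kap"
    using strict_mono_same_range_eq[OF _ strict_mono_chain_diagram[OF k(1)] r] L by blast
  then show "L i = add_box {..<i} (remove_row i (completion d (L 0)))"
    using completion_chain_diagram_0[OF k] by (simp add: chain_diagram_def)
qed

end
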